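(* Let $\mathcal{M}=(W,E,V)$ be an equivalence model, $w\in W$, $\tau$ a modal formula, and $d\in D$ a day. The following are equivalent: (i) In $w$ there is a $\tau$-surprising test on day $d$. (ii) $\mathcal{M},w\models\tau$ and $\mathcal{M}|_{\ge d},w\models\langle T=d\rangle\wedge\neg\Box\langle T=d\rangle$. (iii) $\mathcal{M},w\models\tau\wedge\langle T=d\rangle\wedge\neg\Box\langle T\le d\rangle$ (equivalently, $\mathcal{M},w\models\tau\wedge\langle T=d\rangle\wedge\Diamond\langle T>d\rangle$).
   Context: Modal formulas are built from variables $X_1,\dots,X_5$ and $\bot$ using $\to$ and $\Box$ (usual derived connectives; $\Diamond\varphi:=\neg\Box\neg\varphi$). A Kripke model $\mathcal{M}=(W,E,V)$ has nonempty world set $W$, relation $E$, and a valuation of $X_1,\dots,X_5$ in each world; $\mathcal{M},w\models\Box\varphi$ iff $\varphi$ holds in all $E$-successors of $w$. An equivalence model is one whose $E$ is an equivalence relation. Throughout, only models in which $(\mathrm{Ax}_{\le1})=\bigwedge_{i<j}(\neg X_i\vee\neg X_j)$ holds in every world are considered. Let $R=\{\mathrm{Mo},\mathrm{Tu},\mathrm{We},\mathrm{Th},\mathrm{Fr},\mathrm{none}\}$ with $\mathrm{Mo}<\dots<\mathrm{Fr}<\mathrm{none}$ and $D=\{\mathrm{Mo},\dots,\mathrm{Fr}\}$; put $Y_{\mathrm{Mo}}=X_1,\dots,Y_{\mathrm{Fr}}=X_5$, $Y_{\mathrm{none}}=\neg(X_1\vee\dots\vee X_5)$. A world is an $r$-world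 if $Y_r$ holds in it; a ${>}d$-world is an $r$-world with $r>d$. For $B\subseteq R$: $\langle T\in B\rangle:=\bigvee_{r\in B}Y_r$, $\langle T=r\rangle:=Y_r$, $\langle T\le d\rangle:=\langle T\in\{r:r\le d\}\rangle$, $\langle T>d\rangle:=\langle T\in\{r:r>d\}\rangle$. For a model $\mathcal{M}$ and $d\in D$, $\mathcal{M}|_{\ge d}$ is the submodel obtained by deleting all $d'$-worlds with $d'<d$ (restricting $E$ and $V$). For worlds $w$ in $\mathcal{N}$ and $w'$ in $\mathcal{N}'$, write $(\mathcal{N},w)\equiv_\Box(\mathcal{N}',w')$ if exactly the same formulas of the form $\Box\psi$ hold in $(\mathcal{N},w)$ and in $(\mathcal{N}',w')$. Definition: in world $w$ of an equivalence model $\mathcal{M}$ there is a $\tau$-surprising test on day $d$ if $w$ is a $d$-world with $\mathcal{M},w\models\tau$ and there exist an equivalence model $\mathcal{M}'$ and a ${>}d$-world $w'$ of $\mathcal{M}'$ such that $(\mathcal{M}|_{\ge d},w)\equiv_\Box(\mathcal{M}'|_{\ge d},w')$ (it is not required that $\tau$ hold in $w'$). *)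

theory Defs
  imports Main "HOL-Library.Infinite_Typeclass"
begin

datatype pvar = X1 | X2 | X3 | X4 | X5

datatype fm = Var pvar | Bot | Imp fm fm | Box fm

definition Neg :: "fm \<Rightarrow> fm" where
  "Neg \<phi> = Imp \<phi> Bot"

definition Or :: "fm \<Rightarrow> fm \<Rightarrow> fm" where
  "Or \<phi> \<psi> = Imp (Neg \<phi>) \<psi>"

definition And :: "fm \<Rightarrow> fm \<Rightarrow> fm" where
  "And \<phi> \<psi> = Neg (Imp \<phi> (Neg \<psi>))"

definition Dia :: "fm \<Rightarrow> fm" where
  "Dia \<phi> = Neg (Box (Neg \<phi>))"

fun big_or :: "fm list \<Rightarrow> fm" where
  "big_or [] = Bot"
| "big_or [\<phi>] = \<phi>"
| "big_or (\<phi> # \<psi> # \<phi>s) = Or \<phi> (big_or (\<psi> # \<phi>s))"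

fun big_and :: "fm list \<Rightarrow> fm" where
  "big_and [] = Neg Bot"
| "big_and [\<phi>] = \<phi>"
| "big_and (\<phi> # \<psi> # \<phi>s) = And \<phi> (big_and (\<psi> # \<phi>s))"

definition pvars :: "pvar list" where
  "pvars = [X1, X2, X3, X4, X5]"

definition Ax_le1 :: fm where
  "Ax_le1 = big_and
     [Or (Neg (Var (pvars ! i))) (Neg (Var (pvars ! j))). i \<leftarrow> [0..<5], j \<leftarrow> [Suc i..<5]]"

record 'w kripke =
  worlds :: "'w set"
  access :: "('w \<times> 'w) set"
  valuation :: "'w \<Rightarrow> pvar \<Rightarrow> bool"

primrec sat :: "'w kripke \<Rightarrow> 'w \<Rightarrow> fm \<Rightarrow> bool" where
  "sat M w (Var x) \<longleftrightarrow> valuation M w x"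
| "sat M w Bot \<longleftrightarrow> False"
| "sat M w (Imp \<phi> \<psi>) \<longleftrightarrow> (sat M w \<phi> \<longrightarrow> sat M w \<psi>)"
| "sat M w (Box \<phi>) \<longleftrightarrow> (\<forall>v. (w, v) \<in> access M \<longrightarrow> sat M v \<phi>)"

text \<open>The last conjunct is the standing assumption that at most one variable holds in each world.\<close>

definition kripke_model :: "'w kripke \<Rightarrow> bool" where
  "kripke_model M \<longleftrightarrow>
     worlds M \<noteq> {} \<and> access M \<subseteq> worlds M \<times> worlds M \<and> (\<forall>w \<in> worlds M. sat M w Ax_le1)"

definition equivalence_model :: "'w kripke \<Rightarrow> bool" where
  "equivalence_model M \<longleftrightarrow> kripke_model M \<and> equiv (worlds M) (access M)"

datatype result = Mo | Tu | We | Th | Fr | NoTest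

definition results :: "result list" where
  "results = [Mo, Tu, We, Th, Fr, NoTest]"

primrec result_rank :: "result \<Rightarrow> nat" where
  "result_rank Mo = 0"
| "result_rank Tu = 1"
| "result_rank We = 2"
| "result_rank Th = 3"
| "result_rank Fr = 4"
| "result_rank NoTest = 5"

instantiation result :: linorder
begin

definition less_eq_result :: "result \<Rightarrow> result \<Rightarrow> bool" where
  "r \<le> s \<longleftrightarrow> result_rank r \<le> result_rank s"

definition less_result :: "result \<Rightarrow> result \<Rightarrow> bool" where
  "r < s \<longleftrightarrow> result_rank r < result_rank s"

instance
proof
  fix r s :: result
  assume "r \<le> s" "s \<le> r"
  then show "r = s"
    by (cases r; cases s) (simp_all add: less_eq_result_def)
qed (auto simp: less_eq_result_def less_result_def)

end

definition days :: "result set" where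
  "days = {Mo, Tu, We, Th, Fr}"

primrec Y :: "result \<Rightarrow> fm" where
  "Y Mo = Var X1"
| "Y Tu = Var X2"
| "Y We = Var X3"
| "Y Th = Var X4"
| "Y Fr = Var X5"
| "Y NoTest = Neg (big_or (map Var pvars))"

definition T_in :: "result set \<Rightarrow> fm" where
  "T_in B = big_or (map Y (filter (\<lambda>r. r \<in> B) results))"

definition T_eq :: "result \<Rightarrow> fm" where
  "T_eq r = Y r"

definition T_le :: "result \<Rightarrow> fm" where
  "T_le d = T_in {r. r \<le> d}"

definition T_gt :: "result \<Rightarrow> fm" where
  "T_gt d = T_in {r. r > d}"

definition result_world :: "'w kripke \<Rightarrow> result \<Rightarrow> 'w \<Rightarrow> bool" where
  "result_world M r w \<longleftrightarrow> w \<in> worlds M \<and> sat M w (Y r)"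

definition gt_world :: "'w kripke \<Rightarrow> result \<Rightarrow> 'w \<Rightarrow> bool" where
  "gt_world M d w \<longleftrightarrow> (\<exists>r. r > d \<and> result_world M r w)"

text \<open>The valuation is a total function, so only its values on the remaining worlds matter.\<close>

definition restrict_ge :: "'w kripke \<Rightarrow> result \<Rightarrow> 'w kripke" where
  "restrict_ge M d =
     (let W = {w \<in> worlds M. \<not> (\<exists>d' < d. result_world M d' w)}
      in \<lparr>worlds = W, access = access M \<inter> W \<times> W, valuation = valuation M\<rparr>)"

definition box_equiv :: "'w kripke \<Rightarrow> 'w \<Rightarrow> 'v kripke \<Rightarrow> 'v \<Rightarrow> bool" where
  "box_equiv N w N' w' \<longleftrightarrow> (\<forall>\<psi>. sat N w (Box \<psi>) \<longleftrightarrow> sat N' w' (Box \<psi>))"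

text \<open>
  HOL cannot quantify existentially over the type of worlds of the second model, so that type
  is a parameter \<^typ>\<open>'v\<close> of the definition, independent of the world type of \<open>M\<close>. It should
  be instantiated with infinite types only: a small finite type does not have room for all the
  models that are relevant. Since the carrier is an arbitrary subset of \<^typ>\<open>'v\<close>, an
  infinite type admits finite models as well.
\<close>

definition surprising_test ::
  "'v itself \<Rightarrow> 'w kripke \<Rightarrow> 'w \<Rightarrow> fm \<Rightarrow> result \<Rightarrow> bool" where
  "surprising_test (_ :: 'v itself) M w \<tau> d \<longleftrightarrow>
     result_world M d w \<and> sat M w \<tau> \<and>
     (\<exists>(M' :: 'v kripke) w'. equivalence_model M' \<and> gt_world M' d w' \<and>
        box_equiv (restrict_ge M d) w (restrict_ge M' d) w')"

end

theory Submission
  imports Defs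
begin

text \<open>
  A world that sees itself and satisfies \<open>Box (T_eq d)\<close> is a \<open>d\<close>-world, so a world that is
  box-equivalent to a \<open>>d\<close>-world cannot satisfy \<open>Box (T_eq d)\<close>. Conversely, if \<open>w\<close> sees a
  \<open>>d\<close>-world \<open>u\<close> after the restriction, then \<open>w\<close> and \<open>u\<close> lie in the same cluster, and
  within one cluster the same boxed formulas hold; so \<open>u\<close> itself is a witness. To place the
  witness in an unrelated infinite type, the cluster is replaced by its set of valuations, which
  is finite and bisimilar to it.
\<close>

text \<open>Finitely many variables give finitely many valuations, so the valuations can be embedded
  into any infinite type.\<close>

instance pvar :: finite
proof
  have "(UNIV :: pvar set) \<subseteq> {X1, X2, X3, X4, X5}"
    using pvar.exhaust by auto
  then show "finite (UNIV :: pvar set)"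
    by (rule finite_subset) simp
qed

section \<open>Derived connectives, and the unique result of a world\<close>

lemma sat_connectives [simp]:
  "sat M w (Neg \<phi>) \<longleftrightarrow> \<not> sat M w \<phi>"
  "sat M w (Or \<phi> \<psi>) \<longleftrightarrow> sat M w \<phi> \<or> sat M w \<psi>"
  "sat M w (And \<phi> \<psi>) \<longleftrightarrow> sat M w \<phi> \<and> sat M w \<psi>"
  "sat M w (Dia \<phi>) \<longleftrightarrow> (\<exists>v. (w, v) \<in> access M \<and> sat M v \<phi>)"
  by (auto simp: Neg_def Or_def And_def Dia_def)

lemma sat_big_or [simp]: "sat M w (big_or \<phi>s) \<longleftrightarrow> (\<exists>\<phi> \<in> set \<phi>s. sat M w \<phi>)"
  by (induction \<phi>s rule: big_or.induct) auto

lemma sat_big_and [simp]: "sat M w (big_and \<phi>s) \<longleftrightarrow> (\<forall>\<phi> \<in> set \<phi>s. sat M w \<phi>)"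
  by (induction \<phi>s rule: big_and.induct) auto

lemma set_results: "set results = UNIV"
  using result.exhaust by (auto simp: results_def)

lemma sat_T_in: "sat M w (T_in B) \<longleftrightarrow> (\<exists>r \<in> B. sat M w (Y r))"
  by (auto simp: T_in_def set_results)

lemma sat_Y_cong:
  assumes "valuation M w = valuation N v"
  shows "sat M w (Y r) \<longleftrightarrow> sat N v (Y r)"
  using assms by (cases r) (auto simp: pvars_def)

lemma sat_Ax_le1_cong:
  assumes "valuation M w = valuation N v"
  shows "sat M w Ax_le1 \<longleftrightarrow> sat N v Ax_le1"
  using assms by (simp add: Ax_le1_def)

lemma ex_sat_Y: "\<exists>r. sat M w (Y r)"
proof (cases "sat M w (Y NoTest)")
  case False
  then obtain x where "valuation M w x"
    by auto
  then show ?thesis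
    by (cases x) (auto intro: exI[of _ Mo] exI[of _ Tu] exI[of _ We] exI[of _ Th] exI[of _ Fr])
qed blast

lemma set_pvars: "set pvars = UNIV"
  using pvar.exhaust by (auto simp: pvars_def)

text \<open>The axiom speaks of positions in \<open>pvars\<close>; two distinct variables sit at
  distinct positions, and the conjunct for the smaller and the larger one forbids both.\<close>

lemma Ax_le1_valuation_unique:
  assumes "sat M w Ax_le1" "valuation M w x" "valuation M w y"
  shows "x = y"
proof -
  have disj: "\<not> (valuation M w (pvars ! i) \<and> valuation M w (pvars ! j))" if "i < j" "j < 5" for i j
  proof -
    have "i \<in> set [0..<5]" "j \<in> set [Suc i..<5]"
      using that by (simp_all only: set_upt atLeastLessThan_iff) simp_all
    \<comment> \<open>The inner index runs only over positions above the outer one, which is where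
      \<open>i < j\<close> enters.\<close>
    then have "Or (Neg (Var (pvars ! i))) (Neg (Var (pvars ! j)))
        \<in> set [Or (Neg (Var (pvars ! i))) (Neg (Var (pvars ! j))). i \<leftarrow> [0..<5], j \<leftarrow> [Suc i..<5]]"
      unfolding set_concat set_map by (intro UN_I[OF imageI[of i]]) (simp_all only: set_map, rule imageI)
    then have "sat M w (Or (Neg (Var (pvars ! i))) (Neg (Var (pvars ! j))))"
      using assms(1) unfolding Ax_le1_def sat_big_and by (rule bspec[rotated])
    then show ?thesis
      by simp
  qed
  have "length pvars = 5"
    by (simp add: pvars_def)
  then have "\<exists>i<5. z = pvars ! i" for z
    by (metis set_pvars in_set_conv_nth UNIV_I)
  then obtain i j where ij: "i < 5" "x = pvars ! i" "j < 5" "y = pvars ! j"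
    by meson
  show ?thesis
  proof (cases i j rule: linorder_cases)
    case less
    then show ?thesis
      using disj[of i j] ij assms(2,3) by blast
  next
    case greater
    then show ?thesis
      using disj[of j i] ij assms(2,3) by blast
  qed (use ij in simp)
qed

text \<open>Two different days would need two true variables, while \<open>Y NoTest\<close> refutes
  every variable. With \<open>ex_sat_Y\<close>, each world has exactly one result.\<close>

lemma sat_Y_unique:
  assumes "sat M w Ax_le1" "sat M w (Y r)" "sat M w (Y s)"
  shows "r = s"
  using assms(2,3)
  by (cases r; cases s) (auto simp: set_pvars dest: Ax_le1_valuation_unique[OF assms(1)])

section \<open>Bisimulation invariance and the quotient of a cluster\<close>

lemma bisimulation_sat:
  assumes "Z w v"
    and "\<And>w v. Z w v \<Longrightarrow> valuation M w = valuation N v"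
    and "\<And>w v w'. Z w v \<Longrightarrow> (w, w') \<in> access M \<Longrightarrow> \<exists>v'. (v, v') \<in> access N \<and> Z w' v'"
    and "\<And>w v v'. Z w v \<Longrightarrow> (v, v') \<in> access N \<Longrightarrow> \<exists>w'. (w, w') \<in> access M \<and> Z w' v'"
  shows "sat M w \<phi> \<longleftrightarrow> sat N v \<phi>"
  using assms(1)
proof (induction \<phi> arbitrary: w v)
  case (Box \<phi>)
  then show ?case
    using assms(3,4) by (metis sat.simps(4))
qed (use assms(2) in auto)

text \<open>In a cluster, worlds with equal valuations are bisimilar, so one world per valuation
  suffices, all of them seeing each other. The injection \<open>f\<close> names a valuation by an
  element of the target type, and \<open>inv f\<close> reads it back.\<close>

definition valuation_quotient :: "((pvar \<Rightarrow> bool) \<Rightarrow> 'v) \<Rightarrow> 'w kripke \<Rightarrow> 'w set \<Rightarrow> 'v kripke" where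
  "valuation_quotient f M C =
     (let W = (\<lambda>u. f (valuation M u)) ` C
      in \<lparr>worlds = W, access = W \<times> W, valuation = inv f\<rparr>)"

lemma valuation_quotient_simps [simp]:
  "worlds (valuation_quotient f M C) = (\<lambda>u. f (valuation M u)) ` C"
  "access (valuation_quotient f M C) =
     (\<lambda>u. f (valuation M u)) ` C \<times> (\<lambda>u. f (valuation M u)) ` C"
  "valuation (valuation_quotient f M C) = inv f"
  by (simp_all add: valuation_quotient_def Let_def)

lemma equivalence_model_valuation_quotient:
  assumes "inj f" "C \<noteq> {}" "\<And>u. u \<in> C \<Longrightarrow> sat M u Ax_le1"
  shows "equivalence_model (valuation_quotient f M C)"
proof -
  have "sat (valuation_quotient f M C) (f (valuation M u)) Ax_le1" if "u \<in> C" for u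
    using assms(3)[OF that] sat_Ax_le1_cong[of "valuation_quotient f M C" "f (valuation M u)" M u]
      assms(1) by simp
  then show ?thesis
    using assms(2)
    by (auto simp: equivalence_model_def kripke_model_def equiv_def refl_on_def sym_def trans_def)
qed

text \<open>The graph of the quotient map is a bisimulation: a world of \<open>C\<close> sees
  exactly \<open>C\<close>, and its image sees exactly the image of \<open>C\<close>.\<close>

lemma sat_valuation_quotient:
  assumes "inj f" "u \<in> C" "\<And>x. x \<in> C \<Longrightarrow> access M `` {x} = C"
  shows "sat (valuation_quotient f M C) (f (valuation M u)) \<phi> \<longleftrightarrow> sat M u \<phi>"
proof (rule sym, rule bisimulation_sat[where Z = "\<lambda>x y. x \<in> C \<and> y = f (valuation M x)"])
  show "u \<in> C \<and> f (valuation M u) = f (valuation M u)"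
    using assms(2) by simp
qed (use assms(1,3) in \<open>auto simp: Image_def\<close>)

section \<open>Deleting the worlds with an earlier test\<close>

lemma restrict_ge_simps [simp]:
  "worlds (restrict_ge M d) = {u \<in> worlds M. \<not> (\<exists>d' < d. result_world M d' u)}"
  "access (restrict_ge M d) =
     access M \<inter> worlds (restrict_ge M d) \<times> worlds (restrict_ge M d)"
  "valuation (restrict_ge M d) = valuation M"
  by (auto simp: restrict_ge_def Let_def)

lemma sat_Y_restrict_ge [simp]: "sat (restrict_ge M d) u (Y r) \<longleftrightarrow> sat M u (Y r)"
  by (rule sat_Y_cong) simp

lemma restrict_ge_id:
  assumes "access M \<subseteq> worlds M \<times> worlds M" "\<And>u d'. d' < d \<Longrightarrow> \<not> result_world M d' u"
  shows "restrict_ge M d = (M :: 'w kripke)"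
  using assms by (intro kripke.equality) auto

lemma equivalence_modelD:
  assumes "equivalence_model M"
  shows "access M \<subseteq> worlds M \<times> worlds M" "equiv (worlds M) (access M)"
    and "\<And>u. u \<in> worlds M \<Longrightarrow> sat M u Ax_le1"
  using assms by (auto simp: equivalence_model_def kripke_model_def)

text \<open>As \<open>r\<close> is the only result of \<open>u\<close>, no other result can cause
  its deletion.\<close>

lemma mem_worlds_restrict_ge_iff:
  assumes "equivalence_model M" "u \<in> worlds M" "sat M u (Y r)"
  shows "u \<in> worlds (restrict_ge M d) \<longleftrightarrow> d \<le> r"
proof -
  have "sat M u (Y s) \<longleftrightarrow> s = r" for s
    using sat_Y_unique[OF equivalence_modelD(3)[OF assms(1,2)]] assms(3) by blast
  then show ?thesis
    using assms(2) by (auto simp: result_world_def not_less)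
qed

section \<open>Necessity and sufficiency of a visible later result\<close>

lemma not_Box_T_eq_if_surprising_test:
  assumes "surprising_test TYPE('v) M w \<tau> d"
  shows "\<not> sat (restrict_ge M d) w (Box (T_eq d))"
proof
  assume box: "sat (restrict_ge M d) w (Box (T_eq d))"
  from assms obtain M' :: "'v kripke" and w' r where M': "equivalence_model M'"
    and r: "r > d" "w' \<in> worlds M'" "sat M' w' (Y r)"
    and eq: "box_equiv (restrict_ge M d) w (restrict_ge M' d) w'"
    by (auto simp: surprising_test_def gt_world_def result_world_def)
  \<comment> \<open>Reflexivity is needed in the restricted model, so \<open>w'\<close> must survive
    the deletion; it does because \<open>r > d\<close>.\<close>
  have "w' \<in> worlds (restrict_ge M' d)"
    using mem_worlds_restrict_ge_iff[OF M' r(2,3)] r(1) by (metis less_imp_le)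
  moreover have "(w', w') \<in> access M'"
    using equivalence_modelD(2)[OF M'] r(2) by (auto simp: equiv_def refl_on_def)
  ultimately have "(w', w') \<in> access (restrict_ge M' d)"
    unfolding restrict_ge_simps(2) by blast
  moreover have "sat (restrict_ge M' d) w' (Box (T_eq d))"
    using box eq unfolding box_equiv_def by blast
  ultimately have "sat M' w' (Y d)"
    unfolding sat.simps(4) T_eq_def sat_Y_restrict_ge by blast
  then have "d = r"
    using sat_Y_unique[OF equivalence_modelD(3)[OF M' r(2)]] r(3) by blast
  then show False
    using r(1) by simp
qed

lemma surprising_testI:
  fixes M :: "'w kripke"
  assumes M: "equivalence_model M" and w: "w \<in> worlds M" "sat M w (Y d)" "sat M w \<tau>"
    and u: "(w, u) \<in> access M" "sat M u (Y r)" "r > d"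
  shows "surprising_test TYPE('v::infinite) M w \<tau> d"
proof -
  note M' = equivalence_modelD[OF M]
  obtain f :: "(pvar \<Rightarrow> bool) \<Rightarrow> 'v" where f: "inj f"
    using infinite_arbitrarily_large[OF infinite_UNIV, of "card (UNIV :: (pvar \<Rightarrow> bool) set)"]
      card_le_inj[OF finite_UNIV] by (metis order_refl)
  \<comment> \<open>The cluster is formed after the deletion, so that its quotient \<open>Q\<close>
    contains no earlier test and is unchanged by its own restriction.\<close>
  define N where "N = restrict_ge M d"
  define C where "C = access N `` {w}"
  define Q where "Q = valuation_quotient f N C"
  have uW: "u \<in> worlds M"
    using u(1) M'(1) by blast
  have wN: "w \<in> worlds N" and uN: "u \<in> worlds N"
    unfolding N_def using mem_worlds_restrict_ge_iff[OF M w(1,2), of d]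
      mem_worlds_restrict_ge_iff[OF M uW u(2), of d] u(3) by (auto simp del: restrict_ge_simps)
  have accN: "access N = access M \<inter> worlds N \<times> worlds N"
    unfolding N_def by (rule restrict_ge_simps(2))
  \<comment> \<open>\<open>C\<close> is an equivalence class, hence the class of each of its
    members.\<close>
  have C: "access N `` {x} = C" if "x \<in> C" for x
    using that M'(2) unfolding C_def accN equiv_def sym_def trans_def by blast
  have wC: "w \<in> C"
    using wN w(1) M'(2) unfolding C_def accN equiv_def refl_on_def by blast
  have uC: "u \<in> C"
    using wN uN u(1) unfolding C_def accN by blast
  have CN: "x \<in> worlds N" if "x \<in> C" for x
    using that unfolding C_def accN by blast
  have satQ: "sat Q (f (valuation N x)) \<phi> \<longleftrightarrow> sat N x \<phi>" if "x \<in> C" for x \<phi>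
    unfolding Q_def using sat_valuation_quotient[OF f that C] .
  have "sat N x Ax_le1" if "x \<in> C" for x
    using CN[OF that] M'(3) sat_Ax_le1_cong[of N x M x] by (auto simp: N_def)
  then have eqQ: "equivalence_model Q"
    unfolding Q_def using wC by (intro equivalence_model_valuation_quotient[OF f]) auto
  have "restrict_ge Q d = Q"
  proof (rule restrict_ge_id)
    show "\<not> result_world Q d' y" if "d' < d" for y d'
    proof
      assume "result_world Q d' y"
      then obtain x where x: "x \<in> C" "sat Q (f (valuation N x)) (Y d')"
        by (auto simp: Q_def result_world_def)
      then have "sat M x (Y d')"
        using satQ[OF x(1)] by (simp add: N_def)
      then show False
        using CN[OF x(1)] that by (auto simp: N_def result_world_def)
    qed
  qed (use equivalence_modelD(1)[OF eqQ] in blast)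
  \<comment> \<open>Both worlds have \<open>C\<close> as their set of successors, so they agree on
    boxed formulas although their results differ.\<close>
  moreover have "sat N w (Box \<psi>) \<longleftrightarrow> sat N u (Box \<psi>)" for \<psi>
    using C[OF wC] C[OF uC] by (auto simp: Image_def set_eq_iff)
  ultimately have "box_equiv (restrict_ge M d) w (restrict_ge Q d) (f (valuation N u))"
    unfolding box_equiv_def N_def[symmetric] using satQ[OF uC] by metis
  moreover have "sat Q (f (valuation N u)) (Y r)"
    using satQ[OF uC] u(2) by (simp add: N_def)
  then have "gt_world Q d (f (valuation N u))"
    using u(3) uC by (auto simp: gt_world_def result_world_def Q_def)
  ultimately show ?thesis
    using w eqQ unfolding surprising_test_def result_world_def by blast
qed

theorem theorem6p15:
  fixes M :: "'w kripke" and w :: 'w and \<tau> :: fm and d :: result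
  assumes "equivalence_model M"
    and "w \<in> worlds M"
    and "d \<in> days"
  shows "(surprising_test TYPE('v::infinite) M w \<tau> d
           \<longleftrightarrow> sat M w \<tau> \<and> sat (restrict_ge M d) w (And (T_eq d) (Neg (Box (T_eq d)))))
       \<and> (surprising_test TYPE('v) M w \<tau> d
           \<longleftrightarrow> sat M w (And \<tau> (And (T_eq d) (Neg (Box (T_le d))))))
       \<and> (sat M w (And \<tau> (And (T_eq d) (Neg (Box (T_le d)))))
           \<longleftrightarrow> sat M w (And \<tau> (And (T_eq d) (Dia (T_gt d)))))"
  (is "(?i \<longleftrightarrow> ?ii) \<and> (?i \<longleftrightarrow> ?iii) \<and> (?iii \<longleftrightarrow> ?iii')")
proof -
  have acc: "v \<in> worlds M" if "(w, v) \<in> access M" for v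
    using that equivalence_modelD(1)[OF assms(1)] by blast
  have uniq: "r = s" if "v \<in> worlds M" "sat M v (Y r)" "sat M v (Y s)" for v r s
    using sat_Y_unique[OF equivalence_modelD(3)[OF assms(1) that(1)] that(2,3)] .
  \<comment> \<open>The unique result of \<open>v\<close> lies in exactly one of two complementary
    sets.\<close>
  have gt_iff: "sat M v (T_gt d) \<longleftrightarrow> \<not> sat M v (T_le d)" if "v \<in> worlds M" for v
  proof -
    obtain r where r: "sat M v (Y r)"
      using ex_sat_Y[of M v] by blast
    have "sat M v (Y s) \<longleftrightarrow> s = r" for s
      using uniq[OF that r, of s] r by metis
    then show ?thesis
      unfolding T_gt_def T_le_def sat_T_in by (simp add: not_le)
  qed
  \<comment> \<open>The implications run in a cycle from \<open>?i\<close> through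
    \<open>?ii\<close> and \<open>?iii'\<close> back to \<open>?i\<close>; \<open>?iii\<close> is
    tied to \<open>?iii'\<close> by duality of box and diamond.\<close>
  have "?i \<Longrightarrow> ?ii"
    using not_Box_T_eq_if_surprising_test[of M w \<tau> d, where 'v = 'v]
    by (simp add: surprising_test_def result_world_def T_eq_def del: sat.simps)
  moreover have "?ii \<Longrightarrow> ?iii'"
  proof -
    assume ii: ?ii
    \<comment> \<open>Survival of \<open>v\<close> bounds its result below by \<open>d\<close>, and
      failure of \<open>Y d\<close> makes the bound strict.\<close>
    then obtain v where v: "(w, v) \<in> access M" "v \<in> worlds (restrict_ge M d)"
      "\<not> sat M v (Y d)"
      unfolding sat_connectives sat.simps T_eq_def sat_Y_restrict_ge restrict_ge_simps(2) by blast
    obtain r where r: "sat M v (Y r)"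
      using ex_sat_Y[of M v] by blast
    then have "d \<le> r"
      using mem_worlds_restrict_ge_iff[OF assms(1) acc[OF v(1)] r] v(2) by blast
    then have "d < r"
      using v(3) r by (metis order_le_less)
    then have "sat M v (T_gt d)"
      using r by (auto simp: T_gt_def sat_T_in)
    then show ?iii'
      using ii v(1) unfolding sat_connectives T_eq_def sat_Y_restrict_ge by blast
  qed
  moreover have "?iii' \<Longrightarrow> ?i"
  proof -
    assume iii': ?iii'
    then obtain u r where "(w, u) \<in> access M" "sat M u (Y r)" "r > d"
      unfolding sat_connectives T_gt_def sat_T_in by blast
    then show ?i
      using iii' unfolding sat_connectives T_eq_def by (intro surprising_testI[OF assms(1,2)]) simp_all
  qed
  moreover have "?iii \<longleftrightarrow> ?iii'"
    unfolding sat_connectives sat.simps using gt_iff acc by metis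
  ultimately show ?thesis
    by blast
qed

end
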